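(* Let $n\ge 16$ be an integer. Then there do not exist polynomials $p,q,r,s\in\mathbb{C}[x]$ satisfying all of the following: (i) $p^n+q^n=r^n+s^n\neq 0$ (that is, the two sides are equal as polynomials and are not the zero polynomial); (ii) $\{p^n,q^n\}\neq\{r^n,s^n\}$ as sets; (iii) $\max\{\deg p,\deg q,\deg r,\deg s\}\ge 1$; (iv) $\gcd(p,q,r,s)=1$.
   Context: Here $\gcd(p,q,r,s)=1$ means that the four polynomials have no common nonconstant divisor in $\mathbb{C}[x]$ (they are not required to be pairwise coprime). *)

theory Defs
  imports "HOL-Computational_Algebra.Computational_Algebra"
    "HOL-Computational_Algebra.Field_as_Ring"
begin

(* Field_as_Ring makes complex a field_gcd, so that gcd is available on complex poly. *)

lemma gcd4_eq_1_iff_no_common_nonconstant_divisor: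
  fixes p q r s :: "complex poly"
  shows "gcd p (gcd q (gcd r s)) = 1 \<longleftrightarrow>
    (\<nexists>d. degree d \<ge> 1 \<and> d dvd p \<and> d dvd q \<and> d dvd r \<and> d dvd s)"
    (is "?g = 1 \<longleftrightarrow> ?R")
proof
  assume g: "?g = 1"
  show ?R
  proof
    assume "\<exists>d. degree d \<ge> 1 \<and> d dvd p \<and> d dvd q \<and> d dvd r \<and> d dvd s"
    then obtain d where d: "degree d \<ge> 1" "d dvd p" "d dvd q" "d dvd r" "d dvd s"
      by blast
    have "d dvd ?g" using d by (meson gcd_greatest)
    with g have "d dvd 1" by simp
    with d(1) show False
      by (metis is_unit_iff_degree not_is_unit_0 not_one_le_zero)
  qed
next
  assume R: ?R
  have "?g dvd p" "?g dvd q" "?g dvd r" "?g dvd s"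
    by (auto intro: dvd_trans[OF gcd_dvd2])
  with R have deg: "degree ?g = 0" by (metis less_one not_less)
  have nz: "?g \<noteq> 0"
  proof
    assume "?g = 0"
    then have "p = 0" "q = 0" "r = 0" "s = 0" by auto
    moreover have "degree [:0, 1 :: complex:] \<ge> 1" by simp
    ultimately show False using R by blast
  qed
  have "is_unit ?g" by (rule iffD2[OF is_unit_iff_degree[OF nz] deg])
  then show "?g = 1" by (simp only: is_unit_gcd coprime_iff_gcd_eq_1)
qed

end

theory Submission
  imports Defs
begin

text \<open>
  The Wronskian of \<open>p ^ n, q ^ n, r ^ n\<close> equals \<open>(p q r) ^ (n - 2)\<close> times a polynomial \<open>D\<close> of
  degree at most \<open>2 (deg p + deg q + deg r)\<close>. Replacing one of the three powers by \<open>s ^ n\<close>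
  changes the Wronskian only by a sign, so \<open>s ^ (n - 2)\<close> divides each of \<open>D p ^ (n - 2)\<close>,
  \<open>D q ^ (n - 2)\<close> and \<open>D r ^ (n - 2)\<close>. Since \<open>p, q, r\<close> have no common factor, \<open>s ^ (n - 2)\<close>
  divides \<open>D\<close>. If \<open>s\<close> has the largest degree, this forces \<open>D = 0\<close> for \<open>n \<ge> 9\<close>, hence a linear
  relation between \<open>p ^ n, q ^ n, r ^ n\<close>. Fermat's equation for polynomials then makes two of
  these powers proportional, which turns the original equation into a Fermat equation as well.
\<close>

section \<open>Jets, Wronskians and linear dependence over the constants\<close>

definition wronskian :: "'a::idom poly \<Rightarrow> 'a poly \<Rightarrow> 'a poly" where
  "wronskian f g = f * pderiv g - pderiv f * g"

text \<open>The 3x3 determinant with the given rows, expanded along the first column. Rows are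
  triples, so that determinant identities become ring identities in nine variables.\<close>

definition det3 :: "'a::comm_ring \<times> 'a \<times> 'a \<Rightarrow> 'a \<times> 'a \<times> 'a \<Rightarrow> 'a \<times> 'a \<times> 'a \<Rightarrow> 'a" where
  "det3 = (\<lambda>(a0, a1, a2) (b0, b1, b2) (c0, c1, c2).
    a0 * (b1 * c2 - b2 * c1) - b0 * (a1 * c2 - a2 * c1) + c0 * (a1 * b2 - a2 * b1))"

definition jet :: "'a::idom poly \<Rightarrow> 'a poly \<times> 'a poly \<times> 'a poly" where
  "jet f = (f, pderiv f, pderiv (pderiv f))"

definition wronskian3 :: "'a::idom poly \<Rightarrow> 'a poly \<Rightarrow> 'a poly \<Rightarrow> 'a poly" where
  "wronskian3 f g h = det3 (jet f) (jet g) (jet h)"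

text \<open>The 2-jet of \<open>f ^ (m + 2)\<close> divided by its common factor \<open>f ^ m\<close>.\<close>

definition power_jet :: "nat \<Rightarrow> 'a::idom poly \<Rightarrow> 'a poly \<times> 'a poly \<times> 'a poly" where
  "power_jet m f = (f ^ 2, of_nat (m + 2) * (f * pderiv f),
    of_nat (m + 2) * (of_nat (m + 1) * pderiv f ^ 2 + f * pderiv (pderiv f)))"

definition lin_dep :: "'a::idom poly \<Rightarrow> 'a poly \<Rightarrow> bool" where
  "lin_dep f g \<longleftrightarrow> (\<exists>a b. (a \<noteq> 0 \<or> b \<noteq> 0) \<and> smult a f + smult b g = 0)"

lemma lin_dep_sym: "lin_dep f g \<Longrightarrow> lin_dep g f"
  unfolding lin_dep_def by (metis add.commute)

lemma lin_dep_cases: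
  fixes f g :: "'a::field poly"
  assumes "lin_dep f g"
  obtains c where "f = smult c g" | c where "g = smult c f"
proof -
  obtain a b where ab: "a \<noteq> 0 \<or> b \<noteq> 0" "smult a f + smult b g = 0"
    using assms unfolding lin_dep_def by blast
  have solve: "u = smult (- y / x) v" if "x \<noteq> 0" "smult x u + smult y v = 0" for x y :: 'a and u v
  proof -
    have "smult x u = smult (- y) v"
      using that(2) by (simp add: eq_neg_iff_add_eq_0)
    then have "smult (inverse x) (smult x u) = smult (inverse x) (smult (- y) v)" by simp
    then show ?thesis using that(1) by (simp add: field_simps)
  qed
  from ab(1) show thesis
  proof
    assume "a \<noteq> 0" with ab(2) show thesis using solve that(1) by blast
  next
    assume "b \<noteq> 0" with ab(2) show thesis using solve that(2) by (metis add.commute)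
  qed
qed

text \<open>Cancelling \<open>gcd f g\<close> divides the Wronskian by a square, so the cofactors
  may be taken coprime. Each cofactor then divides its own derivative and is constant in
  characteristic 0.\<close>

lemma wronskian_eq_0_imp_lin_dep:
  fixes f g :: "'a::{field_gcd, field_char_0} poly"
  assumes "wronskian f g = 0"
  shows "lin_dep f g"
proof (cases "f = 0")
  case True
  then have "smult 1 f + smult 0 g = 0" by simp
  then show ?thesis unfolding lin_dep_def by (metis one_neq_zero)
next
  case False
  define d where "d = gcd f g"
  have "d \<noteq> 0" using False by (simp add: d_def)
  obtain f1 g1 where fg: "f = f1 * d" "g = g1 * d" and cop: "coprime f1 g1"
    using gcd_coprime_exists[of f g] False unfolding d_def by auto
  have "wronskian f g = d ^ 2 * wronskian f1 g1"
    by (simp add: fg wronskian_def pderiv_mult algebra_simps power2_eq_square)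
  with assms \<open>d \<noteq> 0\<close> have w: "f1 * pderiv g1 = pderiv f1 * g1"
    by (simp add: wronskian_def)
  have "f1 dvd pderiv f1 * g1" using w by (metis dvd_triv_left)
  then have "f1 dvd pderiv f1" using cop by (simp add: coprime_dvd_mult_left_iff)
  then have "degree f1 = 0" using not_dvd_pderiv by blast
  have "g1 dvd f1 * pderiv g1" using w by simp
  then have "g1 dvd pderiv g1"
    using cop by (simp add: coprime_dvd_mult_right_iff coprime_commute)
  then have "degree g1 = 0" using not_dvd_pderiv by blast
  obtain a b where ab: "f1 = [:a:]" "g1 = [:b:]"
    using \<open>degree f1 = 0\<close> \<open>degree g1 = 0\<close> by (meson degree_eq_zeroE)
  have "- a \<noteq> 0" using False fg ab by auto
  moreover have "smult b f + smult (- a) g = 0" by (simp add: fg ab mult.commute)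
  ultimately show ?thesis unfolding lin_dep_def by blast
qed

text \<open>The products of first derivatives cancel in the derivative of
  \<open>wronskian f u\<close>, so both sides expand to the same polynomial. This reduces order
  three to order two.\<close>

lemma mult_wronskian3:
  "f * wronskian3 f g h = wronskian (wronskian f g) (wronskian f h)"
proof -
  have "pderiv (wronskian f u) = f * pderiv (pderiv u) - pderiv (pderiv f) * u" for u
    by (simp add: wronskian_def pderiv_mult pderiv_diff mult.commute)
  then have "wronskian (wronskian f g) (wronskian f h) =
      (f * pderiv g - pderiv f * g) * (f * pderiv (pderiv h) - pderiv (pderiv f) * h)
      - (f * pderiv (pderiv g) - pderiv (pderiv f) * g) * (f * pderiv h - pderiv f * h)"
    by (simp add: wronskian_def)
  then show ?thesis
    unfolding wronskian3_def det3_def jet_def prod.case by algebra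
qed

text \<open>The order-two criterion is applied twice: first to \<open>wronskian f g\<close> and
  \<open>wronskian f h\<close>, then, by linearity in the second argument, to \<open>f\<close> and a
  combination of \<open>g\<close> and \<open>h\<close>.\<close>

lemma wronskian3_eq_0_imp_lin_dep:
  fixes f g h :: "'a::{field_gcd, field_char_0} poly"
  assumes "wronskian3 f g h = 0"
  shows "\<exists>a b c. (a \<noteq> 0 \<or> b \<noteq> 0 \<or> c \<noteq> 0) \<and> smult a f + smult b g + smult c h = 0"
proof -
  have "wronskian (wronskian f g) (wronskian f h) = 0"
    using mult_wronskian3[of f g h] assms by simp
  then obtain b c where bc: "b \<noteq> 0 \<or> c \<noteq> 0"
      "smult b (wronskian f g) + smult c (wronskian f h) = 0"
    using wronskian_eq_0_imp_lin_dep unfolding lin_dep_def by blast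
  have "wronskian f (smult b g + smult c h) = smult b (wronskian f g) + smult c (wronskian f h)"
    by (simp add: wronskian_def pderiv_add pderiv_smult algebra_simps smult_diff_right)
  with bc have "lin_dep f (smult b g + smult c h)"
    by (simp add: wronskian_eq_0_imp_lin_dep)
  then obtain x y where xy: "x \<noteq> 0 \<or> y \<noteq> 0" "smult x f + smult y (smult b g + smult c h) = 0"
    unfolding lin_dep_def by blast
  have "smult x f + smult (y * b) g + smult (y * c) h = 0"
    using xy(2) by (simp add: smult_add_right add.assoc)
  moreover have "x \<noteq> 0 \<or> y * b \<noteq> 0 \<or> y * c \<noteq> 0" using xy(1) bc(1) by auto
  ultimately show ?thesis by blast
qed

section \<open>Wronskians of linear combinations and of powers\<close>

lemma det3_cycle:
  fixes u :: "'a::idom \<times> 'a \<times> 'a"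
  shows "det3 u v w = det3 v w u"
  by (simp only: det3_def case_prod_beta) algebra

lemma det3_linear_combination:
  fixes a :: "'a::idom"
  shows "det3 (u0, u1, u2) (v0, v1, v2)
      (a * u0 + b * v0 + c * w0, a * u1 + b * v1 + c * w1, a * u2 + b * v2 + c * w2)
    = c * det3 (u0, u1, u2) (v0, v1, v2) (w0, w1, w2)"
  unfolding det3_def prod.case by algebra

text \<open>Jets are linear over constants, and multiples of the first two rows do not affect a
  determinant. This is what allows \<open>s ^ n\<close> to be traded for another power.\<close>

lemma wronskian3_linear_combination:
  "wronskian3 f g (smult a f + smult b g + smult c h) = smult c (wronskian3 f g h)"
proof -
  have "jet (smult a f + smult b g + smult c h) =
      ([:a:] * f + [:b:] * g + [:c:] * h,
       [:a:] * pderiv f + [:b:] * pderiv g + [:c:] * pderiv h,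
       [:a:] * pderiv (pderiv f) + [:b:] * pderiv (pderiv g) + [:c:] * pderiv (pderiv h))"
    by (simp add: jet_def pderiv_add pderiv_smult)
  then have "wronskian3 f g (smult a f + smult b g + smult c h) = [:c:] * wronskian3 f g h"
    unfolding wronskian3_def by (simp only: jet_def det3_linear_combination)
  then show ?thesis by simp
qed

lemma jet_power:
  "jet (f ^ (m + 2)) = (case power_jet m f of (a, b, c) \<Rightarrow> (f ^ m * a, f ^ m * b, f ^ m * c))"
proof -
  have 1: "pderiv (f ^ Suc k) = of_nat (Suc k) * (f ^ k * pderiv f)" for k
    by (simp add: pderiv_power_Suc of_nat_poly del: of_nat_Suc power_Suc)
  have 2: "pderiv (of_nat k * g) = of_nat k * pderiv g" for k and g :: "'a poly"
    by (simp add: pderiv_mult)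
  have "pderiv (pderiv (f ^ (m + 2))) =
      of_nat (m + 2) * (of_nat (m + 1) * (f ^ m * pderiv f * pderiv f) + f ^ (m + 1) * pderiv (pderiv f))"
    using 1[of "Suc m"] 1[of m] by (simp add: 2 pderiv_mult algebra_simps del: power_Suc of_nat_Suc)
  moreover have "pderiv (f ^ (m + 2)) = of_nat (m + 2) * (f ^ (m + 1) * pderiv f)"
    using 1[of "Suc m"] by simp
  ultimately show ?thesis
    by (simp add: jet_def power_jet_def power_add power2_eq_square algebra_simps)
qed

text \<open>Each row of the determinant contributes its common factor \<open>f ^ m\<close>,
  \<open>g ^ m\<close> or \<open>h ^ m\<close>.\<close>

lemma wronskian3_power:
  "wronskian3 (f ^ (m + 2)) (g ^ (m + 2)) (h ^ (m + 2)) =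
    f ^ m * g ^ m * h ^ m * det3 (power_jet m f) (power_jet m g) (power_jet m h)"
  unfolding wronskian3_def jet_power
proof -
  obtain a0 a1 a2 b0 b1 b2 c0 c1 c2 where eq: "power_jet m f = (a0, a1, a2)"
      "power_jet m g = (b0, b1, b2)" "power_jet m h = (c0, c1, c2)"
    by (metis prod_cases3)
  show "det3 (case power_jet m f of (a, b, c) \<Rightarrow> (f ^ m * a, f ^ m * b, f ^ m * c))
     (case power_jet m g of (a, b, c) \<Rightarrow> (g ^ m * a, g ^ m * b, g ^ m * c))
     (case power_jet m h of (a, b, c) \<Rightarrow> (h ^ m * a, h ^ m * b, h ^ m * c)) =
    f ^ m * g ^ m * h ^ m * det3 (power_jet m f) (power_jet m g) (power_jet m h)"
    unfolding eq det3_def by (simp add: algebra_simps)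
qed

lemma degree_pderiv_le: "degree (pderiv f) \<le> degree f"
  by (rule degree_le) (auto simp: coeff_pderiv coeff_eq_0)

text \<open>Each entry of \<open>power_jet m x\<close> has degree at most twice that of
  \<open>x\<close>, and each term of the determinant takes one entry from every row. The drop in
  degree under differentiation is ignored.\<close>

lemma degree_det3_power_jet_le:
  "degree (det3 (power_jet m f) (power_jet m g) (power_jet m h))
    \<le> 2 * (degree f + degree g + degree h)"
proof -
  have of_nat: "degree (of_nat k * y) \<le> degree y" for k and y :: "'a poly"
    by (metis add_0 degree_mult_le degree_of_nat)
  have d1: "degree (pderiv x) \<le> degree x" for x :: "'a poly" by (rule degree_pderiv_le)
  have prod: "degree (x * y) \<le> i + j" if "degree x \<le> i" "degree y \<le> j" for x y :: "'a poly" and i j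
    using degree_mult_le[of x y] that by linarith
  obtain a0 a1 a2 b0 b1 b2 c0 c1 c2 where eq: "power_jet m f = (a0, a1, a2)"
      "power_jet m g = (b0, b1, b2)" "power_jet m h = (c0, c1, c2)"
    by (metis prod_cases3)
  have jet: "degree x0 \<le> 2 * degree x \<and> degree x1 \<le> 2 * degree x \<and> degree x2 \<le> 2 * degree x"
    if "power_jet m x = (x0, x1, x2)" for x x0 x1 x2 :: "'a poly"
  proof -
    have "degree (x * pderiv x) \<le> 2 * degree x" "degree (pderiv x * pderiv x) \<le> 2 * degree x"
      "degree (x * pderiv (pderiv x)) \<le> 2 * degree x" "degree (x * x) \<le> 2 * degree x"
      unfolding mult_2 by (intro prod d1 order_trans[OF d1 d1] order_refl)+
    then show ?thesis
      using that unfolding power_jet_def power2_eq_square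
      by (auto intro!: order_trans[OF of_nat] degree_add_le simp del: of_nat_add of_nat_Suc)
  qed
  have "degree (x * (y * z - y' * z')) \<le> 2 * (degree f + degree g + degree h)"
    if "degree x \<le> i" "degree y \<le> j" "degree z \<le> k" "degree y' \<le> j" "degree z' \<le> k"
      "i + (j + k) = 2 * (degree f + degree g + degree h)" for x y z y' z' :: "'a poly" and i j k
    unfolding that(6)[symmetric] by (intro prod degree_diff_le that)
  then show ?thesis
    unfolding eq det3_def using jet[OF eq(1)] jet[OF eq(2)] jet[OF eq(3)]
    by (auto intro!: degree_add_le degree_diff_le)
qed

section \<open>Three terms\<close>

text \<open>The relation and its derivative show that \<open>r ^ (n - 1)\<close> divides
  \<open>wronskian p q\<close>. That has degree at most \<open>2 * degree r\<close>, whereas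
  \<open>n - 1\<close> is at least 3.\<close>

lemma fermat_max_degree:
  fixes p q r :: "'a::{field_gcd, field_char_0} poly"
  assumes n: "n \<ge> 4" and eq: "smult a (p ^ n) + smult b (q ^ n) + smult c (r ^ n) = 0"
    and nz: "a \<noteq> 0" "b \<noteq> 0" "c \<noteq> 0"
    and cop: "coprime p q" "coprime p r"
    and max: "degree p \<le> degree r" "degree q \<le> degree r"
  shows "degree r = 0"
proof -
  obtain k where k: "n = Suc k" using n by (cases n) auto
  have "smult a (pderiv (p ^ n)) + smult b (pderiv (q ^ n)) + smult c (pderiv (r ^ n)) = 0"
    using arg_cong[OF eq, of pderiv] by (simp add: pderiv_add pderiv_smult)
  then have "smult (of_nat n) (smult a (p ^ k * pderiv p) + smult b (q ^ k * pderiv q)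
      + smult c (r ^ k * pderiv r)) = 0"
    unfolding k pderiv_power_Suc
    by (simp add: smult_add_right mult.commute del: of_nat_Suc)
  then have eq': "smult a (p ^ k * pderiv p) + smult b (q ^ k * pderiv q)
      + smult c (r ^ k * pderiv r) = 0"
    using n by simp
  \<comment> \<open>Multiplying the differentiated relation by \<open>q\<close> and the original one
    by \<open>pderiv q\<close> eliminates the \<open>q ^ n\<close> term from the difference.\<close>
  have "(smult a (p ^ k * pderiv p) + smult b (q ^ k * pderiv q) + smult c (r ^ k * pderiv r)) * q
      - (smult a (p ^ n) + smult b (q ^ n) + smult c (r ^ n)) * pderiv q
      = r ^ k * smult c (pderiv r * q - r * pderiv q) - smult a (p ^ k * wronskian p q)"
    by (simp add: k wronskian_def algebra_simps smult_diff_right)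
  then have "smult a (p ^ k * wronskian p q) = r ^ k * smult c (pderiv r * q - r * pderiv q)"
    using eq eq' by simp
  then have "r ^ k dvd smult a (p ^ k * wronskian p q)" by (metis dvd_triv_left)
  then have "r ^ k dvd p ^ k * wronskian p q" using nz by (simp add: dvd_smult_iff)
  moreover have "coprime (r ^ k) (p ^ k)" using cop by (simp add: coprime_commute)
  ultimately have dvd: "r ^ k dvd wronskian p q" by (simp add: coprime_dvd_mult_right_iff)
  show ?thesis
  proof (cases "wronskian p q = 0")
    \<comment> \<open>The divisibility says nothing here, but coprime \<open>p\<close> and
      \<open>q\<close> with vanishing Wronskian are constant, and the relation then makes
      \<open>r ^ n\<close> constant.\<close>
    case True
    then have w: "p * pderiv q = pderiv p * q" by (simp add: wronskian_def)
    have "p dvd pderiv p * q" "q dvd p * pderiv q" using w by (metis dvd_triv_left, simp)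
    then have "p dvd pderiv p" "q dvd pderiv q"
      using cop by (simp_all add: coprime_dvd_mult_left_iff coprime_dvd_mult_right_iff coprime_commute)
    then have "degree p = 0" "degree q = 0" using not_dvd_pderiv by blast+
    then obtain x y where "p = [:x:]" "q = [:y:]" by (meson degree_eq_zeroE)
    then have "smult c (r ^ n) = [:- (a * x ^ n + b * y ^ n):]"
      using eq by (simp add: poly_const_pow eq_neg_iff_add_eq_0[symmetric] add.commute)
    then have "degree (r ^ n) = 0" using nz by (metis degree_pCons_0 degree_smult_eq)
    then show ?thesis using n by (cases "r = 0") (auto simp: degree_power_eq)
  next
    case False
    have "degree (wronskian p q) \<le> degree p + degree q"
      unfolding wronskian_def
      by (intro degree_diff_le order_trans[OF degree_mult_le] add_mono degree_pderiv_le order_refl)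
    moreover have "degree (r ^ k) \<le> degree (wronskian p q)"
      using dvd False by (rule dvd_imp_degree_le)
    moreover have "degree (r ^ k) = k * degree r"
      by (cases "r = 0") (auto simp: degree_power_eq power_0_left)
    moreover have "k * degree r \<ge> 3 * degree r" using n k by simp
    ultimately show ?thesis using max by linarith
  qed
qed

text \<open>The relation gives that \<open>d ^ n\<close> divides \<open>r ^ n\<close>, and n-th
  roots may be taken in a divisibility. It makes coprimality of one pair spread to all
  pairs.\<close>

lemma dvd_of_power_linear_combination:
  fixes d p q r :: "'a::field_gcd poly"
  assumes "smult a (p ^ n) + smult b (q ^ n) + smult c (r ^ n) = 0" "c \<noteq> 0" "n > 0"
    and "d dvd p" "d dvd q"
  shows "d dvd r"
proof -
  have "smult c (r ^ n) = - (smult a (p ^ n) + smult b (q ^ n))"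
    unfolding eq_neg_iff_add_eq_0 using assms(1) by (simp add: add_ac)
  moreover have "d ^ n dvd smult a (p ^ n)" "d ^ n dvd smult b (q ^ n)"
    using assms by (simp_all add: dvd_smult dvd_power_same)
  ultimately have "d ^ n dvd smult c (r ^ n)" by (simp only: dvd_minus_iff dvd_add)
  then show ?thesis using assms by (simp add: dvd_smult_iff)
qed

text \<open>The relation is cyclically symmetric once all pairs are known to be coprime, so
  whichever polynomial has the largest degree can play the role of \<open>r\<close> in
  \<open>fermat_max_degree\<close>.\<close>

lemma fermat_coprime:
  fixes p q r :: "'a::{field_gcd, field_char_0} poly"
  assumes n: "n \<ge> 4" and eq: "smult a (p ^ n) + smult b (q ^ n) + smult c (r ^ n) = 0"
    and nz: "a \<noteq> 0" "b \<noteq> 0" "c \<noteq> 0" and pq: "coprime p q"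
  shows "degree p = 0 \<and> degree q = 0 \<and> degree r = 0"
proof -
  have eqs: "smult b (q ^ n) + smult c (r ^ n) + smult a (p ^ n) = 0"
    "smult c (r ^ n) + smult a (p ^ n) + smult b (q ^ n) = 0"
    using eq by (simp_all add: add_ac)
  have "n > 0" using n by simp
  have "coprime q r"
  proof (rule coprimeI)
    fix d assume "d dvd q" "d dvd r"
    then have "d dvd p" by (rule dvd_of_power_linear_combination[OF eqs(1) nz(1) \<open>n > 0\<close>])
    then show "is_unit d" using \<open>d dvd q\<close> by (rule coprime_common_divisor[OF pq])
  qed
  have "coprime r p"
  proof (rule coprimeI)
    fix d assume "d dvd r" "d dvd p"
    then have "d dvd q" by (rule dvd_of_power_linear_combination[OF eqs(2) nz(2) \<open>n > 0\<close>])
    with \<open>d dvd p\<close> show "is_unit d" by (rule coprime_common_divisor[OF pq])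
  qed
  have cop: "coprime p r" "coprime q p" "coprime r q"
    using \<open>coprime r p\<close> pq \<open>coprime q r\<close> by (simp_all only: coprime_commute)
  consider "degree p \<le> degree r" "degree q \<le> degree r" | "degree q \<le> degree p" "degree r \<le> degree p"
    | "degree r \<le> degree q" "degree p \<le> degree q" by linarith
  then show ?thesis
  proof cases
    case 1
    then show ?thesis using fermat_max_degree[OF n eq nz pq cop(1) 1] by simp
  next
    case 2
    then show ?thesis
      using fermat_max_degree[OF n eqs(1) nz(2,3,1) \<open>coprime q r\<close> cop(2) 2] by simp
  next
    case 3
    then show ?thesis
      using fermat_max_degree[OF n eqs(2) nz(3,1,2) \<open>coprime r p\<close> cop(3) 3] by simp
  qed
qed

text \<open>A nonzero \<open>gcd p q\<close> also divides \<open>r\<close> and cancels from the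
  relation, which leaves the coprime case with constant cofactors.\<close>

lemma fermat:
  fixes p q r :: "'a::{field_gcd, field_char_0} poly"
  assumes n: "n \<ge> 4" and eq: "smult a (p ^ n) + smult b (q ^ n) + smult c (r ^ n) = 0"
    and nz: "a \<noteq> 0" "b \<noteq> 0" "c \<noteq> 0"
  shows "\<exists>g x y z. p = smult x g \<and> q = smult y g \<and> r = smult z g"
proof (cases "gcd p q = 0")
  case True
  then have "p = 0" "q = 0" by auto
  with eq nz n have "r = 0" by (simp add: power_0_left)
  then show ?thesis using \<open>p = 0\<close> \<open>q = 0\<close> by (metis smult_0_right)
next
  case False
  define g where "g = gcd p q"
  obtain p1 q1 where pq: "p = p1 * g" "q = q1 * g" and cop: "coprime p1 q1"
    using gcd_coprime_exists[OF False] unfolding g_def by auto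
  have "g dvd r"
    using dvd_of_power_linear_combination[OF eq nz(3)] n by (simp add: g_def)
  then obtain r1 where r: "r = r1 * g" by (metis dvdE mult.commute)
  have "g ^ n * (smult a (p1 ^ n) + smult b (q1 ^ n) + smult c (r1 ^ n)) = 0"
    using eq unfolding pq r by (simp only: power_mult_distrib) (simp add: algebra_simps)
  then have "smult a (p1 ^ n) + smult b (q1 ^ n) + smult c (r1 ^ n) = 0"
    using False unfolding g_def by (metis mult_eq_0_iff power_not_zero)
  then have "degree p1 = 0 \<and> degree q1 = 0 \<and> degree r1 = 0"
    using fermat_coprime[OF n _ nz cop] by blast
  then obtain x y z where "p1 = [:x:]" "q1 = [:y:]" "r1 = [:z:]" by (meson degree_eq_zeroE)
  then show ?thesis using pq r by auto
qed

section \<open>Four terms\<close>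

text \<open>By \<open>fermat\<close>, \<open>y\<close>, \<open>z\<close> and \<open>w\<close> are
  multiples of one \<open>g\<close>. Proportionality of the powers makes \<open>g\<close> divide
  \<open>x\<close> too, so \<open>g\<close> is a unit.\<close>

lemma lin_dep_powers_imp_constant:
  fixes x y z w :: "'a::{field_gcd, field_char_0} poly"
  assumes n: "n \<ge> 4" and xy: "x ^ n = smult k (y ^ n)"
    and eq: "smult a (y ^ n) + smult b (z ^ n) + smult c (w ^ n) = 0"
    and nz: "a \<noteq> 0" "b \<noteq> 0" "c \<noteq> 0"
    and cop: "\<And>d. d dvd x \<Longrightarrow> d dvd y \<Longrightarrow> d dvd z \<Longrightarrow> d dvd w \<Longrightarrow> is_unit d"
  shows "degree x = 0 \<and> degree y = 0 \<and> degree z = 0 \<and> degree w = 0"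
proof -
  obtain g i j l where g: "y = smult i g" "z = smult j g" "w = smult l g"
    using fermat[OF n eq nz] by blast
  have "g ^ n dvd x ^ n" unfolding xy g smult_power by (intro dvd_smult dvd_refl)
  then have "g dvd x" using n by simp
  then have "is_unit g" using cop g by (simp add: dvd_smult)
  then have "degree g = 0" by (metis is_unit_iff_degree not_is_unit_0)
  then have "degree y = 0" "degree z = 0" "degree w = 0" using g by simp_all
  moreover have "degree (x ^ n) \<le> degree (y ^ n)" unfolding xy by (rule degree_smult_le)
  ultimately have "degree (x ^ n) = 0"
    by (metis degree_power_le le_zero_eq mult_zero_left order_trans)
  then have "degree x = 0" using n by (cases "x = 0") (auto simp: degree_power_eq)
  then show ?thesis using g \<open>degree g = 0\<close> by simp
qed

text \<open>The Wronskian of the powers of \<open>p\<close>, \<open>q\<close>, \<open>s\<close> is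
  computed in two ways, and \<open>p ^ m * q ^ m\<close> is cancelled. Coefficients lie only in an
  integral domain, so \<open>e\<close> supplies the inverse of \<open>c\<close>.\<close>

lemma power_dvd_det3:
  fixes p q r s :: "'a::idom poly"
  assumes "s ^ (m + 2) = smult a (p ^ (m + 2)) + smult b (q ^ (m + 2)) + smult c (r ^ (m + 2))"
    and "p \<noteq> 0" "q \<noteq> 0" "e * c = 1"
  shows "s ^ m dvd det3 (power_jet m p) (power_jet m q) (power_jet m r) * r ^ m"
proof -
  let ?D = "det3 (power_jet m p) (power_jet m q)"
  have "p ^ m * q ^ m * s ^ m * ?D (power_jet m s) =
      wronskian3 (p ^ (m + 2)) (q ^ (m + 2)) (s ^ (m + 2))"
    by (rule wronskian3_power[symmetric])
  also have "\<dots> = smult c (wronskian3 (p ^ (m + 2)) (q ^ (m + 2)) (r ^ (m + 2)))"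
    by (simp only: assms(1) wronskian3_linear_combination)
  also have "\<dots> = smult c (p ^ m * q ^ m * r ^ m * ?D (power_jet m r))"
    by (simp only: wronskian3_power)
  finally have "p ^ m * q ^ m * (s ^ m * ?D (power_jet m s)) =
      p ^ m * q ^ m * smult c (?D (power_jet m r) * r ^ m)"
    by (simp only: mult_smult_right mult_ac)
  then have "s ^ m * ?D (power_jet m s) = smult c (?D (power_jet m r) * r ^ m)"
    using assms(2,3) by (simp only: mult_cancel_left mult_eq_0_iff power_eq_0_iff) blast
  then have "smult e (s ^ m * ?D (power_jet m s)) = ?D (power_jet m r) * r ^ m"
    using assms(4) by (simp only: smult_smult smult_1_left)
  then have "?D (power_jet m r) * r ^ m = s ^ m * smult e (?D (power_jet m s))"
    by (simp only: mult_smult_right)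
  then show ?thesis by (simp only: dvd_triv_left)
qed

lemma four_powers_lin_dep:
  fixes p q r s :: "'a::{field_gcd, field_char_0} poly"
  assumes n: "n \<ge> 9" and eq: "p ^ n + q ^ n = r ^ n + s ^ n"
    and cop: "\<And>d. d dvd p \<Longrightarrow> d dvd q \<Longrightarrow> d dvd r \<Longrightarrow> d dvd s \<Longrightarrow> is_unit d"
    and max: "degree p \<le> degree s" "degree q \<le> degree s" "degree r \<le> degree s" "degree s \<ge> 1"
  shows "lin_dep (p ^ n) (q ^ n) \<or> lin_dep (p ^ n) (r ^ n) \<or> lin_dep (q ^ n) (r ^ n)"
proof -
  obtain m where m: "n = m + 2" using n that[of "n - 2"] by simp
  \<comment> \<open>A zero power is dependent on anything, which settles the case that
    \<open>power_dvd_det3\<close> excludes.\<close>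
  have lin_dep_0: "lin_dep (0 ^ n) y" for y :: "'a poly"
    using n unfolding lin_dep_def by (intro exI[of _ 1] exI[of _ 0]) (simp add: power_0_left)
  show ?thesis
  proof (cases "p = 0 \<or> q = 0 \<or> r = 0")
    case True
    then show ?thesis using lin_dep_0 lin_dep_sym by metis
  next
    case False
    let ?D = "det3 (power_jet m p) (power_jet m q) (power_jet m r)"
    \<comment> \<open>The same equation in three cyclic orders, so that each of \<open>r\<close>,
      \<open>p\<close>, \<open>q\<close> stands once in the last place, where its power survives in
      the divisibility.\<close>
    have s1: "s ^ (m + 2) = smult 1 (p ^ (m + 2)) + smult 1 (q ^ (m + 2)) + smult (- 1) (r ^ (m + 2))"
      and s2: "s ^ (m + 2) = smult 1 (q ^ (m + 2)) + smult (- 1) (r ^ (m + 2)) + smult 1 (p ^ (m + 2))"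
      and s3: "s ^ (m + 2) = smult (- 1) (r ^ (m + 2)) + smult 1 (p ^ (m + 2)) + smult 1 (q ^ (m + 2))"
      using eq unfolding m by (simp_all add: algebra_simps)
    have "s ^ m dvd ?D * r ^ m" "s ^ m dvd ?D * p ^ m" "s ^ m dvd ?D * q ^ m"
      using power_dvd_det3[OF s1, of "- 1"] power_dvd_det3[OF s2, of 1] power_dvd_det3[OF s3, of 1] False
        det3_cycle[of "power_jet m p" "power_jet m q" "power_jet m r"]
        det3_cycle[of "power_jet m q" "power_jet m r" "power_jet m p"]
      by simp_all
    then have "s ^ m dvd gcd (?D * p ^ m) (gcd (?D * q ^ m) (?D * r ^ m))"
      by (intro gcd_greatest)
    \<comment> \<open>A common divisor of three of the polynomials divides the fourth by the
      equation, so joint coprimality of all four suffices.\<close>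
    moreover have "is_unit (gcd p (gcd q r))"
    proof (rule cop)
      let ?t = "gcd p (gcd q r)"
      show t: "?t dvd p" "?t dvd q" "?t dvd r" by (auto intro: dvd_trans[OF gcd_dvd2])
      have "?t ^ n dvd p ^ n + q ^ n - r ^ n" using t by (intro dvd_add dvd_diff dvd_power_same)
      also have "p ^ n + q ^ n - r ^ n = s ^ n" using eq by simp
      finally show "?t dvd s" using n by simp
    qed
    then have "gcd (p ^ m) (gcd (q ^ m) (r ^ m)) = 1"
      by (simp add: gcd_exp)
    then have "gcd (?D * p ^ m) (gcd (?D * q ^ m) (?D * r ^ m)) dvd ?D"
      by (simp add: gcd_mult_left)
    ultimately have dvd: "s ^ m dvd ?D" by (rule dvd_trans)
    have "?D = 0"
    proof (rule ccontr)
      assume "?D \<noteq> 0"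
      then have "degree (s ^ m) \<le> degree ?D" by (rule dvd_imp_degree_le[OF dvd])
      also have "\<dots> \<le> 2 * (degree p + degree q + degree r)" by (rule degree_det3_power_jet_le)
      also have "\<dots> \<le> 6 * degree s" using max by simp
      finally have "degree (s ^ m) \<le> 6 * degree s" .
      moreover have "degree (s ^ m) = m * degree s" using max by (intro degree_power_eq) auto
      \<comment> \<open>The bound \<open>n \<ge> 9\<close> enters here: \<open>m = n - 2\<close>
        must exceed the 6 of the degree estimate.\<close>
      moreover have "m * degree s \<ge> 7 * degree s" using n m by simp
      ultimately show False using max by linarith
    qed
    then have "wronskian3 (p ^ n) (q ^ n) (r ^ n) = 0" unfolding m wronskian3_power by simp
    then obtain a b c where abc: "a \<noteq> 0 \<or> b \<noteq> 0 \<or> c \<noteq> 0"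
        "smult a (p ^ n) + smult b (q ^ n) + smult c (r ^ n) = 0"
      using wronskian3_eq_0_imp_lin_dep by blast
    show ?thesis
    proof (cases "a \<noteq> 0 \<and> b \<noteq> 0 \<and> c \<noteq> 0")
      case False
      then consider "a = 0" "b \<noteq> 0 \<or> c \<noteq> 0" | "b = 0" "a \<noteq> 0 \<or> c \<noteq> 0" | "c = 0" "a \<noteq> 0 \<or> b \<noteq> 0"
        using abc(1) by blast
      then show ?thesis
        using abc(2) by cases (auto simp only: lin_dep_def smult_0_left add_0_left add_0_right)
    next
      \<comment> \<open>With all coefficients nonzero, \<open>fermat\<close> makes \<open>p\<close>
        and \<open>q\<close> constant multiples of one polynomial, so their powers are
        dependent.\<close>
      case True
      have "n \<ge> 4" using n by simp
      from fermat[OF this abc(2)] True obtain g x y where g: "p = smult x g" "q = smult y g"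
        by blast
      have "x \<noteq> 0" using g \<open>\<not> (p = 0 \<or> q = 0 \<or> r = 0)\<close> by auto
      moreover have "smult (y ^ n) (p ^ n) + smult (- (x ^ n)) (q ^ n) = 0"
        unfolding g smult_power by (simp add: mult.commute)
      ultimately have "lin_dep (p ^ n) (q ^ n)" unfolding lin_dep_def
        by (metis neg_equal_0_iff_equal power_not_zero)
      then show ?thesis ..
    qed
  qed
qed

text \<open>Proportional powers merge into one term, whether they stand on the same side
  (\<open>same\<close>) or on opposite sides (\<open>opposite\<close>). What is left is a three-term
  relation, whose merged coefficient must be shown nonzero.\<close>

lemma four_powers_lin_dep_imp_constant:
  fixes p q r s :: "'a::{field_gcd, field_char_0} poly"
  assumes n: "n \<ge> 4" and eq: "p ^ n + q ^ n = r ^ n + s ^ n" and nz: "p ^ n + q ^ n \<noteq> 0"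
    and ne: "{p ^ n, q ^ n} \<noteq> {r ^ n, s ^ n}"
    and cop: "\<And>d. d dvd p \<Longrightarrow> d dvd q \<Longrightarrow> d dvd r \<Longrightarrow> d dvd s \<Longrightarrow> is_unit d"
    and dep: "lin_dep (p ^ n) (q ^ n) \<or> lin_dep (p ^ n) (r ^ n)"
  shows "degree p = 0 \<and> degree q = 0 \<and> degree r = 0 \<and> degree s = 0"
proof -
  have same: "degree x = 0 \<and> degree y = 0 \<and> degree r = 0 \<and> degree s = 0"
    if k: "x ^ n = smult k (y ^ n)" and xy: "{x, y} = {p, q}" "x ^ n + y ^ n = p ^ n + q ^ n" for x y k
  proof (rule lin_dep_powers_imp_constant[OF n k, of "1 + k" "- 1" r "- 1" s])
    have "smult (1 + k) (y ^ n) = r ^ n + s ^ n"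
      using xy(2) eq k by (simp add: smult_add_left add.commute)
    then show "smult (1 + k) (y ^ n) + smult (- 1) (r ^ n) + smult (- 1) (s ^ n) = 0" by simp
    \<comment> \<open>Otherwise both sides of the equation would vanish, against
      \<open>nz\<close>.\<close>
    show "1 + k \<noteq> 0" using \<open>smult (1 + k) (y ^ n) = r ^ n + s ^ n\<close> eq nz by auto
  qed (use cop xy(1) in \<open>auto simp: doubleton_eq_iff\<close>)
  have opposite: "degree x = 0 \<and> degree y = 0 \<and> degree z = 0 \<and> degree w = 0"
    if k: "x ^ n = smult k (y ^ n)" and eq': "x ^ n + z ^ n = y ^ n + w ^ n" and zw: "z ^ n \<noteq> w ^ n"
      and cop': "\<And>d. d dvd x \<Longrightarrow> d dvd y \<Longrightarrow> d dvd z \<Longrightarrow> d dvd w \<Longrightarrow> is_unit d"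
    for x y z w :: "'a poly" and k
  proof (rule lin_dep_powers_imp_constant[OF n k, of "k - 1" 1 z "- 1" w])
    show e: "smult (k - 1) (y ^ n) + smult 1 (z ^ n) + smult (- 1) (w ^ n) = 0"
      using eq' k by (simp add: smult_diff_left algebra_simps)
    \<comment> \<open>For \<open>k = 1\<close> the proportional powers would cancel and leave
      \<open>z ^ n = w ^ n\<close>.\<close>
    show "k - 1 \<noteq> 0" using e zw by auto
  qed (use cop' in auto)
  \<comment> \<open>Equality here would force \<open>p ^ n = r ^ n\<close> as well, and the two sets
    would coincide.\<close>
  have qs: "q ^ n \<noteq> s ^ n" using eq ne by auto
  from dep show ?thesis
  proof
    assume "lin_dep (p ^ n) (q ^ n)"
    then show ?thesis
    proof (cases rule: lin_dep_cases)
      case (1 k)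
      show ?thesis using same[OF 1 refl refl] by simp
    next
      case (2 k)
      show ?thesis using same[OF 2 insert_commute add.commute] by simp
    qed
  next
    assume "lin_dep (p ^ n) (r ^ n)"
    then show ?thesis
    proof (cases rule: lin_dep_cases)
      case (1 k)
      have "degree p = 0 \<and> degree r = 0 \<and> degree q = 0 \<and> degree s = 0"
        by (rule opposite[OF 1 eq qs]) (rule cop)
      then show ?thesis by simp
    next
      case (2 k)
      have "degree r = 0 \<and> degree p = 0 \<and> degree s = 0 \<and> degree q = 0"
        by (rule opposite[OF 2 eq[symmetric] qs[symmetric]]) (rule cop)
      then show ?thesis by simp
    qed
  qed
qed

lemma four_powers_max_degree_eq_0:
  fixes p q r s :: "'a::{field_gcd, field_char_0} poly"
  assumes n: "n \<ge> 9" and eq: "p ^ n + q ^ n = r ^ n + s ^ n" and nz: "p ^ n + q ^ n \<noteq> 0"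
    and ne: "{p ^ n, q ^ n} \<noteq> {r ^ n, s ^ n}"
    and cop: "\<And>d. d dvd p \<Longrightarrow> d dvd q \<Longrightarrow> d dvd r \<Longrightarrow> d dvd s \<Longrightarrow> is_unit d"
    and max: "degree p \<le> degree s" "degree q \<le> degree s" "degree r \<le> degree s"
  shows "degree s = 0"
proof (rule ccontr)
  assume "degree s \<noteq> 0"
  then have "degree s \<ge> 1" by simp
  have "n \<ge> 4" using n by simp
  have "\<not> (lin_dep (p ^ n) (q ^ n) \<or> lin_dep (p ^ n) (r ^ n))"
    using four_powers_lin_dep_imp_constant[OF \<open>n \<ge> 4\<close> eq nz ne cop] \<open>degree s \<noteq> 0\<close> by blast
  \<comment> \<open>The remaining pair is reduced to the previous ones by exchanging
    \<open>p\<close> and \<open>q\<close>.\<close>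
  moreover have "\<not> lin_dep (q ^ n) (r ^ n)"
  proof
    assume dep: "lin_dep (q ^ n) (r ^ n)"
    have "degree q = 0 \<and> degree p = 0 \<and> degree r = 0 \<and> degree s = 0"
    proof (rule four_powers_lin_dep_imp_constant[OF \<open>n \<ge> 4\<close>])
      show "q ^ n + p ^ n = r ^ n + s ^ n" "q ^ n + p ^ n \<noteq> 0" using eq nz by (simp_all add: add.commute)
      show "{q ^ n, p ^ n} \<noteq> {r ^ n, s ^ n}" using ne by (simp add: insert_commute)
    qed (use dep cop in blast)+
    then show False using \<open>degree s \<noteq> 0\<close> by simp
  qed
  ultimately show False
    using four_powers_lin_dep[OF n eq cop max \<open>degree s \<ge> 1\<close>] by blast
qed

theorem theorem2p1:
  fixes n :: nat
  assumes "n \<ge> 16"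
  shows "\<not> (\<exists>p q r s :: complex poly.
      p ^ n + q ^ n = r ^ n + s ^ n \<and> r ^ n + s ^ n \<noteq> 0 \<and>
      {p ^ n, q ^ n} \<noteq> {r ^ n, s ^ n} \<and>
      Max {degree p, degree q, degree r, degree s} \<ge> 1 \<and>
      gcd p (gcd q (gcd r s)) = 1)"
proof
  assume "\<exists>p q r s :: complex poly.
      p ^ n + q ^ n = r ^ n + s ^ n \<and> r ^ n + s ^ n \<noteq> 0 \<and>
      {p ^ n, q ^ n} \<noteq> {r ^ n, s ^ n} \<and>
      Max {degree p, degree q, degree r, degree s} \<ge> 1 \<and>
      gcd p (gcd q (gcd r s)) = 1"
  then obtain p q r s :: "complex poly" where
    eq: "p ^ n + q ^ n = r ^ n + s ^ n" and nz: "r ^ n + s ^ n \<noteq> 0" and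
    ne: "{p ^ n, q ^ n} \<noteq> {r ^ n, s ^ n}" and
    deg: "Max {degree p, degree q, degree r, degree s} \<ge> 1" and
    gcd: "gcd p (gcd q (gcd r s)) = 1" by (elim exE conjE) (rule that)
  have n: "n \<ge> 9" using assms by simp
  \<comment> \<open>The polynomial of largest degree is renamed \<open>w\<close>. Recording the
    renaming as an equality of sets suffices, because the gcd and degree conditions are symmetric in
    the four polynomials.\<close>
  have False if eq': "x ^ n + y ^ n = z ^ n + w ^ n" and nz': "x ^ n + y ^ n \<noteq> 0"
    and ne': "{x ^ n, y ^ n} \<noteq> {z ^ n, w ^ n}" and perm: "{x, y, z, w} = {p, q, r, s}"
    and max: "degree x \<le> degree w" "degree y \<le> degree w" "degree z \<le> degree w" for x y z w
  proof -
    have "is_unit d" if "d dvd x" "d dvd y" "d dvd z" "d dvd w" for d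
    proof -
      have "\<forall>u\<in>{p, q, r, s}. d dvd u" using that unfolding perm[symmetric] by simp
      then have "d dvd gcd p (gcd q (gcd r s))" by simp
      then show ?thesis using gcd by simp
    qed
    from four_powers_max_degree_eq_0[OF n eq' nz' ne' this max] have "degree w = 0" .
    then have "\<forall>u\<in>{x, y, z, w}. degree u = 0" using max by simp
    then show False using deg unfolding perm by simp
  qed
  note main = this
  consider "degree p \<le> degree s" "degree q \<le> degree s" "degree r \<le> degree s"
    | "degree p \<le> degree r" "degree q \<le> degree r" "degree s \<le> degree r"
    | "degree r \<le> degree q" "degree s \<le> degree q" "degree p \<le> degree q"
    | "degree r \<le> degree p" "degree s \<le> degree p" "degree q \<le> degree p"
    by linarith
  then show False
  proof cases
    case 1
    show False by (rule main[OF eq _ ne refl 1]) (simp add: eq nz)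
  next
    case 2
    have "p ^ n + q ^ n = s ^ n + r ^ n" using eq by (simp only: add.commute)
    moreover have "{p ^ n, q ^ n} \<noteq> {s ^ n, r ^ n}" using ne by (metis insert_commute)
    moreover have "{p, q, s, r} = {p, q, r, s}" by blast
    ultimately show False using main[OF _ _ _ _ 2] eq nz by simp
  next
    \<comment> \<open>When the largest degree occurs on the left, the two sides of the equation are
      exchanged first.\<close>
    case 3
    have "{r, s, p, q} = {p, q, r, s}" by blast
    then show False using main[OF eq[symmetric] nz ne[symmetric] _ 3] by simp
  next
    case 4
    have "r ^ n + s ^ n = q ^ n + p ^ n" using eq by (simp only: add.commute)
    moreover have "{r ^ n, s ^ n} \<noteq> {q ^ n, p ^ n}" using ne by (metis insert_commute)
    moreover have "{r, s, q, p} = {p, q, r, s}" by blast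
    ultimately show False using main[OF _ nz _ _ 4] by blast
  qed
qed

end
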